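(* Let $R$ be a simple left artinian ring. Then there exist a division ring $D$ and a positive integer $n$ such that $R\cong M_n(D)$.
   Context: All rings are associative and unital, not necessarily commutative. A ring $R$ is simple if it is nonzero and its only (two-sided) ideals are $\{0\}$ and $R$. A left ideal is an additive subgroup $I$ of $R$ with $xu\in I$ for all $x\in R$, $u\in I$. A ring $R$ is left artinian if for every descending chain $L_1\supseteq L_2\supseteq L_3\supseteq\dots$ of left ideals of $R$ there is an $n_0\in\mathbb{N}$ such that $L_n=L_{n_0}$ for all $n\ge n_0$. A division ring is a nonzero ring in which every nonzero element is invertible. $M_n(D)$ is the ring of $n\times n$ matrices with entries in $D$, and $\cong$ denotes ring isomorphism. *)

theory Defs
  imports "HOL-Algebra.QuotRing"
begin

locale simple_ring = ring R for R (structure) +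
  assumes nonzero: "carrier R \<noteq> {\<zero>}"
    and trivial_ideals: "ideal I R \<Longrightarrow> I = {\<zero>} \<or> I = carrier R"

locale left_ideal = additive_subgroup I R + ring R for I and R (structure) +
  assumes left_closed: "\<lbrakk>x \<in> carrier R; u \<in> I\<rbrakk> \<Longrightarrow> x \<otimes> u \<in> I"

locale left_artinian_ring = ring R for R (structure) +
  assumes descending_chain_condition:
    "\<lbrakk>\<And>n::nat. left_ideal (L n) R; \<And>n. L (Suc n) \<subseteq> L n\<rbrakk>
      \<Longrightarrow> \<exists>n\<^sub>0. \<forall>n\<ge>n\<^sub>0. L n = L n\<^sub>0"

locale division_ring = ring R for R (structure) +
  assumes nonzero: "carrier R \<noteq> {\<zero>}"
    and invertible: "\<lbrakk>x \<in> carrier R; x \<noteq> \<zero>\<rbrakk> \<Longrightarrow> x \<in> Units R"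

text \<open>
  An \<open>n \<times> n\<close> matrix over \<open>R\<close> is a function on \<open>{..<n} \<times> {..<n}\<close>, so rows and columns are
  indexed from \<open>0\<close>. Taking extensional functions makes equality of matrices coincide with
  equality of entries.
\<close>
definition matrix_ring ::
    "nat \<Rightarrow> ('a, 'm) ring_scheme \<Rightarrow> (nat \<times> nat \<Rightarrow> 'a) ring" where
  "matrix_ring n R =
    \<lparr>carrier = {..<n} \<times> {..<n} \<rightarrow>\<^sub>E carrier R,
     mult = (\<lambda>A B. \<lambda>(i, j) \<in> {..<n} \<times> {..<n}.
       \<Oplus>\<^bsub>R\<^esub>k\<in>{..<n}. A (i, k) \<otimes>\<^bsub>R\<^esub> B (k, j)),
     one = (\<lambda>(i, j) \<in> {..<n} \<times> {..<n}. if i = j then \<one>\<^bsub>R\<^esub> else \<zero>\<^bsub>R\<^esub>),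
     zero = (\<lambda>(i, j) \<in> {..<n} \<times> {..<n}. \<zero>\<^bsub>R\<^esub>),
     add = (\<lambda>A B. \<lambda>(i, j) \<in> {..<n} \<times> {..<n}. A (i, j) \<oplus>\<^bsub>R\<^esub> B (i, j))\<rparr>"

end

theory Submission
  imports Defs
begin

text \<open>
  In a simple ring, \<open>a R b = 0\<close> forces \<open>a = 0\<close> or \<open>b = 0\<close>. A minimal left ideal therefore does not
  square to zero, so it is generated by an idempotent \<open>e\<close>, and \<open>D = e R e\<close> is a division ring.
  Consider families \<open>u\<^sub>i \<in> R e\<close>, \<open>v\<^sub>i \<in> e R\<close> (\<open>i < n\<close>) with \<open>v\<^sub>i u\<^sub>j = \<delta>\<^sub>i\<^sub>j e\<close>. If
  \<open>g = 1 - \<Sum> u\<^sub>i v\<^sub>i\<close> is nonzero, then \<open>e R g R e \<noteq> 0\<close> yields a further pair, and the left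
  annihilator of the \<open>u\<^sub>i\<close> strictly decreases. By the chain condition some family has
  \<open>\<Sum> u\<^sub>i v\<^sub>i = 1\<close>, and then \<open>r \<mapsto> (v\<^sub>i r u\<^sub>j)\<close> is an isomorphism onto \<open>M\<^sub>n(D)\<close> with inverse
  \<open>A \<mapsto> \<Sum> u\<^sub>i A\<^sub>i\<^sub>j v\<^sub>j\<close>.
\<close>

text \<open>For an idempotent \<open>e\<close> the carrier is \<open>e R e\<close>, written as the
  elements that \<open>e\<close> fixes from both sides. The unit is \<open>e\<close>. The record is
  built afresh, without the extension fields of \<open>R\<close>, so its type is the plain
  \<open>'a ring\<close>.\<close>

definition corner :: "('a, 'm) ring_scheme \<Rightarrow> 'a \<Rightarrow> 'a ring" where
  "corner R e = \<lparr>carrier = {x \<in> carrier R. e \<otimes>\<^bsub>R\<^esub> x = x \<and> x \<otimes>\<^bsub>R\<^esub> e = x},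
    mult = mult R, one = e, zero = \<zero>\<^bsub>R\<^esub>, add = add R\<rparr>"

text \<open>For idempotent \<open>e\<close>, the absorption equations encode membership in
  \<open>R e\<close> and \<open>e R\<close>, and the products \<open>u i \<otimes> v j\<close>
  behave like matrix units. Only indices below \<open>n\<close> are constrained, so a family can be
  prolonged by a function update at \<open>n\<close>.\<close>

definition dual_family ::
    "('a, 'm) ring_scheme \<Rightarrow> 'a \<Rightarrow> nat \<Rightarrow> (nat \<Rightarrow> 'a) \<Rightarrow> (nat \<Rightarrow> 'a) \<Rightarrow> bool" where
  "dual_family R e n u v \<longleftrightarrow>
    (\<forall>i<n. u i \<in> carrier R \<and> v i \<in> carrier R \<and> u i \<otimes>\<^bsub>R\<^esub> e = u i \<and> e \<otimes>\<^bsub>R\<^esub> v i = v i) \<and>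
    (\<forall>i<n. \<forall>j<n. v i \<otimes>\<^bsub>R\<^esub> u j = (if i = j then e else \<zero>\<^bsub>R\<^esub>))"

definition left_annihilator :: "('a, 'm) ring_scheme \<Rightarrow> 'a set \<Rightarrow> 'a set" where
  "left_annihilator R S = {r \<in> carrier R. \<forall>s\<in>S. r \<otimes>\<^bsub>R\<^esub> s = \<zero>\<^bsub>R\<^esub>}"

section \<open>Left ideals, the minimum condition and primeness\<close>

lemma (in ring) minus_eq_zeroD:
  assumes "x \<ominus> y = \<zero>" "x \<in> carrier R" "y \<in> carrier R"
  shows "x = y"
  using minus_equality[of x "\<ominus> y"] assms by (simp add: minus_eq)

text \<open>Closure under negation need not be checked separately: it is multiplication by
  \<open>\<ominus> \<one>\<close>.\<close>

lemma (in ring) left_idealI: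
  assumes "I \<subseteq> carrier R" "\<zero> \<in> I"
    and "\<And>x y. x \<in> I \<Longrightarrow> y \<in> I \<Longrightarrow> x \<oplus> y \<in> I"
    and "\<And>x u. x \<in> carrier R \<Longrightarrow> u \<in> I \<Longrightarrow> x \<otimes> u \<in> I"
  shows "left_ideal I R"
proof -
  have neg: "\<ominus> x \<in> I" if "x \<in> I" for x
  proof -
    have "(\<ominus> \<one>) \<otimes> x \<in> I"
      using assms(4) that by simp
    then show ?thesis
      using that assms(1) by (simp add: l_minus subset_iff)
  qed
  have "subgroup I (add_monoid R)"
    using assms neg by (intro add.subgroupI) (auto simp: a_inv_def)
  then show ?thesis
    using assms by (auto simp: left_ideal_def left_ideal_axioms_def additive_subgroup_def ring_axioms)
qed

lemma (in ring) left_ideal_annihilator: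
  assumes "S \<subseteq> carrier R"
  shows "left_ideal (left_annihilator R S) R"
proof (rule left_idealI)
  fix x u assume "x \<in> carrier R" "u \<in> left_annihilator R S"
  then show "x \<otimes> u \<in> left_annihilator R S"
    using assms by (auto simp: left_annihilator_def m_assoc subset_iff)
qed (use assms in \<open>auto simp: left_annihilator_def l_distr subset_iff\<close>)

lemma (in ring) left_ideal_Int:
  assumes "left_ideal I R" "left_ideal J R"
  shows "left_ideal (I \<inter> J) R"
proof -
  interpret I: left_ideal I R by fact
  interpret J: left_ideal J R by fact
  show ?thesis
    by (rule left_idealI) (use I.a_subset in \<open>auto intro: I.left_closed J.left_closed\<close>)
qed

lemma (in ring) left_ideal_image:
  assumes "left_ideal I R" "a \<in> carrier R"
  shows "left_ideal ((\<lambda>x. x \<otimes> a) ` I) R"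
proof -
  interpret I: left_ideal I R by fact
  show ?thesis
  proof (rule left_idealI)
    show "\<zero> \<in> (\<lambda>x. x \<otimes> a) ` I"
      using assms(2) by (auto intro!: image_eqI[of _ _ \<zero>])
  next
    fix x y assume "x \<in> (\<lambda>x. x \<otimes> a) ` I" "y \<in> (\<lambda>x. x \<otimes> a) ` I"
    then obtain x' y' where "x' \<in> I" "y' \<in> I" "x = x' \<otimes> a" "y = y' \<otimes> a"
      by auto
    then show "x \<oplus> y \<in> (\<lambda>x. x \<otimes> a) ` I"
      using assms(2) by (auto intro!: image_eqI[of _ _ "x' \<oplus> y'"] simp: l_distr)
  next
    fix x u assume "x \<in> carrier R" "u \<in> (\<lambda>x. x \<otimes> a) ` I"
    then obtain u' where "u' \<in> I" "u = u' \<otimes> a"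
      by auto
    then show "x \<otimes> u \<in> (\<lambda>x. x \<otimes> a) ` I"
      using assms(2) \<open>x \<in> carrier R\<close>
      by (auto intro!: image_eqI[of _ _ "x \<otimes> u'"] I.left_closed simp: m_assoc)
  qed (use assms(2) in auto)
qed

text \<open>The chain condition makes strict inclusion well-founded on any family of left ideals.
  The family is arbitrary because two are needed later: the nonzero left ideals, and the
  annihilators of dual families.\<close>

lemma (in left_artinian_ring) minimal_left_ideal_in:
  assumes "\<And>L. L \<in> \<S> \<Longrightarrow> left_ideal L R" "\<S> \<noteq> {}"
  shows "\<exists>L\<in>\<S>. \<forall>L'\<in>\<S>. L' \<subseteq> L \<longrightarrow> L' = L"
proof -
  have "wf {(I, J). I \<in> \<S> \<and> J \<in> \<S> \<and> I \<subset> J}"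
    unfolding wf_iff_no_infinite_down_chain
  proof
    assume "\<exists>f. \<forall>i. (f (Suc i), f i) \<in> {(I, J). I \<in> \<S> \<and> J \<in> \<S> \<and> I \<subset> J}"
    then obtain f where "\<forall>i. (f (Suc i), f i) \<in> {(I, J). I \<in> \<S> \<and> J \<in> \<S> \<and> I \<subset> J}" ..
    then have f: "\<And>i. f i \<in> \<S>" "\<And>i::nat. f (Suc i) \<subset> f i"
      by auto
    then obtain m where "\<forall>n\<ge>m. f n = f m"
      using descending_chain_condition[of f] assms(1) by blast
    then have "f (Suc m) = f m"
      by (meson le_SucI order_refl)
    then show False
      using f(2)[of m] by blast
  qed
  moreover obtain L0 where "L0 \<in> \<S>"
    using assms(2) by blast
  ultimately obtain L where "L \<in> \<S>"
    "\<And>L'. (L', L) \<in> {(I, J). I \<in> \<S> \<and> J \<in> \<S> \<and> I \<subset> J} \<Longrightarrow> L' \<notin> \<S>"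
    by (rule wfE_min) blast
  then show ?thesis
    by blast
qed

text \<open>The elements \<open>x\<close> with \<open>a R x = 0\<close> form a two-sided ideal.
  Since \<open>a\<close> is nonzero, this ideal misses \<open>\<one>\<close>; by simplicity it is
  zero and cannot contain \<open>b\<close>.\<close>

lemma (in simple_ring) prime:
  assumes "a \<in> carrier R" "b \<in> carrier R" "a \<noteq> \<zero>" "b \<noteq> \<zero>"
  obtains r where "r \<in> carrier R" "a \<otimes> r \<otimes> b \<noteq> \<zero>"
proof -
  define I where "I = {x \<in> carrier R. \<forall>r\<in>carrier R. a \<otimes> r \<otimes> x = \<zero>}"
  have left: "x \<otimes> u \<in> I" if xu: "x \<in> carrier R" "u \<in> I" for x u
  proof -
    have "a \<otimes> r \<otimes> (x \<otimes> u) = a \<otimes> (r \<otimes> x) \<otimes> u" if "r \<in> carrier R" for r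
      using assms xu that by (simp add: m_assoc I_def)
    then show ?thesis
      using xu by (simp add: I_def)
  qed
  have right: "u \<otimes> x \<in> I" if "x \<in> carrier R" "u \<in> I" for x u
    using that assms by (simp add: I_def m_assoc[symmetric])
  have "left_ideal I R"
    by (rule left_idealI) (use assms left in \<open>auto simp: I_def r_distr\<close>)
  then have "subgroup I (add_monoid R)"
    by (simp add: left_ideal_def additive_subgroup_def)
  then have "ideal I R"
    by (rule idealI[OF ring_axioms]) (rule left right; assumption)+
  moreover have "a \<otimes> \<one> \<otimes> \<one> \<noteq> \<zero>"
    using assms by simp
  then have "\<one> \<notin> I"
    unfolding I_def by blast
  ultimately have "I = {\<zero>}"
    using trivial_ideals[of I] by auto
  then have "b \<notin> I"
    using assms by simp
  then show thesis
    using assms(2) that unfolding I_def by blast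
qed

section \<open>Corner rings and minimal left ideals\<close>

lemma (in ring) corner_ring:
  assumes e: "e \<in> carrier R" "e \<otimes> e = e"
  shows "ring (corner R e)"
proof (rule ringI)
  show "abelian_group (corner R e)"
  proof (rule abelian_groupI)
    fix x assume x: "x \<in> carrier (corner R e)"
    then show "\<exists>y\<in>carrier (corner R e). y \<oplus>\<^bsub>corner R e\<^esub> x = \<zero>\<^bsub>corner R e\<^esub>"
      using e by (intro bexI[of _ "\<ominus> x"]) (auto simp: corner_def l_neg l_minus r_minus)
  qed (use e in \<open>auto simp: corner_def l_distr r_distr a_ac\<close>)
  show "monoid (corner R e)"
  proof (rule monoidI)
    fix x y assume "x \<in> carrier (corner R e)" "y \<in> carrier (corner R e)"
    then show "x \<otimes>\<^bsub>corner R e\<^esub> y \<in> carrier (corner R e)"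
      using e by (auto simp: corner_def m_assoc) (simp add: m_assoc[symmetric])
  qed (use e in \<open>auto simp: corner_def m_assoc\<close>)
qed (simp_all add: corner_def l_distr r_distr)

text \<open>Matrix products over the corner are sums taken in the corner, whereas the computations
  with \<open>u\<close> and \<open>v\<close> take place in \<open>R\<close>; this lemma passes
  between the two.\<close>

lemma (in ring) finsum_corner:
  assumes e: "e \<in> carrier R" "e \<otimes> e = e"
    and f: "f \<in> A \<rightarrow> carrier (corner R e)"
  shows "finsum (corner R e) f A = finsum R f A"
proof -
  interpret C: ring "corner R e"
    using e by (rule corner_ring)
  have zero: "\<zero>\<^bsub>corner R e\<^esub> = \<zero>"
    by (simp add: corner_def)
  show ?thesis
    using f
  proof (induction A rule: infinite_finite_induct)
    case (insert x A)
    then show ?case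
      by (subst C.finsum_insert finsum_insert; auto simp: corner_def)+
  qed (simp_all add: zero finsum_infinite C.finsum_infinite)
qed

text \<open>Primeness yields \<open>a\<close> in \<open>L\<close> with \<open>L a\<close> nonzero.
  By minimality, right multiplication by \<open>a\<close> maps \<open>L\<close> bijectively onto
  itself. A preimage \<open>e\<close> of \<open>a\<close> is idempotent, because
  \<open>e \<otimes> e\<close> is another preimage.\<close>

lemma (in ring) idempotent_of_minimal_left_ideal:
  assumes "simple_ring R" and L: "left_ideal L R" "L \<noteq> {\<zero>}"
    and min: "\<And>J. left_ideal J R \<Longrightarrow> J \<subseteq> L \<Longrightarrow> J \<noteq> {\<zero>} \<Longrightarrow> J = L"
  obtains e where "e \<in> L" "e \<noteq> \<zero>" "e \<otimes> e = e"
proof -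
  interpret simple_ring R by fact
  interpret L: left_ideal L R by fact
  obtain b where b: "b \<in> L" "b \<noteq> \<zero>"
    using L by auto
  then obtain r where r: "r \<in> carrier R" "b \<otimes> r \<otimes> b \<noteq> \<zero>"
    using prime[of b b] by auto
  define a where "a = r \<otimes> b"
  have a: "a \<in> L" "b \<otimes> a \<noteq> \<zero>"
    using b r by (auto simp: a_def m_assoc intro: L.left_closed)
  have "(\<lambda>x. x \<otimes> a) ` L = L"
  proof (rule min)
    show "left_ideal ((\<lambda>x. x \<otimes> a) ` L) R"
      using L a by (intro left_ideal_image) auto
  qed (use a b in \<open>auto intro!: L.left_closed\<close>)
  then have "a \<in> (\<lambda>x. x \<otimes> a) ` L"
    using a by simp
  then obtain e where e: "e \<in> L" "e \<otimes> a = a"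
    by (metis imageE)
  \<comment> \<open>This is the kernel of right multiplication by \<open>a\<close> on
    \<open>L\<close>. Were it nonzero, it would be all of \<open>L\<close> and contain
    \<open>b\<close>, against \<open>b \<otimes> a \<noteq> \<zero>\<close>.\<close>
  have "L \<inter> left_annihilator R {a} = {\<zero>}"
  proof (rule ccontr)
    assume "L \<inter> left_annihilator R {a} \<noteq> {\<zero>}"
    then have "L \<inter> left_annihilator R {a} = L"
      using L a by (intro min left_ideal_Int left_ideal_annihilator) auto
    then show False
      using a b by (auto simp: left_annihilator_def)
  qed
  moreover have "e \<otimes> e \<ominus> e \<in> L \<inter> left_annihilator R {a}"
  proof -
    have "(e \<otimes> e \<ominus> e) \<otimes> a = \<zero>"
      using e a by (simp add: minus_eq l_distr l_minus m_assoc r_neg)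
    then show ?thesis
      using e a by (auto simp: left_annihilator_def minus_eq intro!: L.left_closed L.a_closed L.a_inv_closed)
  qed
  ultimately have "e \<otimes> e = e"
    using e minus_eq_zeroD by auto
  moreover have "e \<noteq> \<zero>"
    using a b e by auto
  ultimately show thesis
    using e that by blast
qed

text \<open>A nonzero \<open>x\<close> in the corner equals \<open>x \<otimes> e\<close>, so it lies
  in \<open>L\<close>, and \<open>L x\<close> is a nonzero left ideal inside \<open>L\<close>.
  Minimality puts \<open>e\<close> into \<open>L x\<close>, which gives left inverses.\<close>

lemma (in ring) corner_division_ring:
  assumes L: "left_ideal L R"
    and min: "\<And>J. left_ideal J R \<Longrightarrow> J \<subseteq> L \<Longrightarrow> J \<noteq> {\<zero>} \<Longrightarrow> J = L"
    and e: "e \<in> L" "e \<noteq> \<zero>" "e \<otimes> e = e"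
  shows "division_ring (corner R e)"
proof -
  interpret L: left_ideal L R by fact
  have eR: "e \<in> carrier R"
    using e by auto
  interpret C: ring "corner R e"
    using eR e by (intro corner_ring)
  have left_inverse: "\<exists>y\<in>carrier (corner R e). y \<otimes> x = e"
    if x: "x \<in> carrier (corner R e)" "x \<noteq> \<zero>" for x
  proof -
    have xR: "x \<in> carrier R" "e \<otimes> x = x" "x \<otimes> e = x"
      using x by (auto simp: corner_def)
    have xL: "x \<in> L"
      using L.left_closed[of x e] xR e by simp
    have "(\<lambda>y. y \<otimes> x) ` L = L"
    proof (rule min)
      show "left_ideal ((\<lambda>x'. x' \<otimes> x) ` L) R"
        using L xR by (intro left_ideal_image) auto
      have "x \<in> (\<lambda>y. y \<otimes> x) ` L"
        using e xR by (intro image_eqI[of _ _ e]) auto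
      then show "(\<lambda>y. y \<otimes> x) ` L \<noteq> {\<zero>}"
        using x by blast
    qed (use xL in \<open>auto intro!: L.left_closed\<close>)
    then have "e \<in> (\<lambda>y. y \<otimes> x) ` L"
      using e by simp
    then obtain z where z: "z \<in> L" "z \<otimes> x = e"
      by (metis imageE)
    \<comment> \<open>\<open>z\<close> is only known to lie in \<open>L\<close>; compressing it by
      \<open>e\<close> on both sides moves it into the corner and keeps the product with
      \<open>x\<close>.\<close>
    have "e \<otimes> z \<otimes> e \<in> carrier (corner R e)"
      using z eR e by (auto simp: corner_def m_assoc) (simp add: m_assoc[symmetric])
    moreover have "e \<otimes> z \<otimes> e \<otimes> x = e"
      using z eR e xR by (simp add: m_assoc)
    ultimately show ?thesis
      by blast
  qed
  show ?thesis
  proof (intro division_ring.intro division_ring_axioms.intro C.ring_axioms)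
    show "carrier (corner R e) \<noteq> {\<zero>\<^bsub>corner R e\<^esub>}"
    proof
      assume "carrier (corner R e) = {\<zero>\<^bsub>corner R e\<^esub>}"
      then have "e = \<zero>"
        using C.one_closed by (simp add: corner_def)
      then show False
        using e by simp
    qed
  next
    fix x assume x: "x \<in> carrier (corner R e)" "x \<noteq> \<zero>\<^bsub>corner R e\<^esub>"
    have z: "\<zero>\<^bsub>corner R e\<^esub> = \<zero>" "\<one>\<^bsub>corner R e\<^esub> = e" "mult (corner R e) = mult R"
      by (auto simp: corner_def)
    obtain y where y: "y \<in> carrier (corner R e)" "y \<otimes> x = e"
      using left_inverse x by (auto simp: z)
    have "y \<noteq> \<zero>"
      using y x e by (auto simp: corner_def)
    \<comment> \<open>The left inverse \<open>y\<close> has a left inverse in turn, which must be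
      \<open>x\<close>; hence \<open>y\<close> is a two-sided inverse of \<open>x\<close>.\<close>
    then obtain w where w: "w \<in> carrier (corner R e)" "w \<otimes> y = e"
      using left_inverse y by blast
    have "w = x"
      using C.m_assoc[of w y x] x y w C.l_one[of x] C.r_one[of w] by (simp add: z)
    then show "x \<in> Units (corner R e)"
      using x y w by (auto simp: Units_def z)
  qed
qed

section \<open>Dual families and their extension\<close>

locale dual_basis = ring R for R (structure) +
  fixes e n u v
  assumes e: "e \<in> carrier R" "e \<otimes> e = e"
    and dual: "dual_family R e n u v"
begin

lemma closed [simp]: "i < n \<Longrightarrow> u i \<in> carrier R" "i < n \<Longrightarrow> v i \<in> carrier R"
  and absorb [simp]: "i < n \<Longrightarrow> u i \<otimes> e = u i" "i < n \<Longrightarrow> e \<otimes> v i = v i"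
  and v_u: "i < n \<Longrightarrow> j < n \<Longrightarrow> v i \<otimes> u j = (if i = j then e else \<zero>)"
  using dual by (auto simp: dual_family_def)

text \<open>The sum of the orthogonal idempotents \<open>u i \<otimes> v i\<close>. The locale does
  not assume the family complete; completeness is the equation \<open>f = \<one>\<close>.\<close>

definition f where "f = (\<Oplus>i\<in>{..<n}. u i \<otimes> v i)"

lemma f_closed [simp]: "f \<in> carrier R"
  by (auto simp: f_def)

lemma f_u: assumes j: "j < n" shows "f \<otimes> u j = u j"
proof -
  have "f \<otimes> u j = (\<Oplus>i\<in>{..<n}. u i \<otimes> v i \<otimes> u j)"
    unfolding f_def using j by (intro finsum_ldistr) auto
  also have "\<dots> = (\<Oplus>i\<in>{..<n}. if j = i then u i else \<zero>)"
    using j by (intro finsum_cong') (auto simp: m_assoc v_u)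
  also have "\<dots> = u j"
    using j by (intro add.finprod_singleton) auto
  finally show ?thesis .
qed

lemma v_f: assumes j: "j < n" shows "v j \<otimes> f = v j"
proof -
  have "v j \<otimes> f = (\<Oplus>i\<in>{..<n}. v j \<otimes> (u i \<otimes> v i))"
    unfolding f_def using j by (intro finsum_rdistr) auto
  also have "\<dots> = (\<Oplus>i\<in>{..<n}. if j = i then v i else \<zero>)"
    using j by (intro finsum_cong') (auto simp: m_assoc[symmetric] v_u)
  also have "\<dots> = v j"
    using j by (intro add.finprod_singleton) auto
  finally show ?thesis .
qed

text \<open>The complementary idempotent \<open>g\<close> kills every \<open>u j\<close> from the
  left and every \<open>v j\<close> from the right, so a pair routed through \<open>g\<close> is
  orthogonal to the old ones. The strict decrease of annihilators is what rules out extending a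
  minimal family.\<close>

lemma extend:
  assumes "simple_ring R" "division_ring (corner R e)" "f \<noteq> \<one>" "e \<noteq> \<zero>"
  obtains x y where "dual_family R e (Suc n) (u(n := x)) (v(n := y))"
    "left_annihilator R ((u(n := x)) ` {..<Suc n}) \<subset> left_annihilator R (u ` {..<n})"
proof -
  interpret simple_ring R by fact
  define g where "g = \<one> \<ominus> f"
  have g [simp]: "g \<in> carrier R" and g0: "g \<noteq> \<zero>"
    using assms(3) minus_eq_zeroD[of \<one> f] by (auto simp: g_def)
  have g_u: "g \<otimes> u j = \<zero>" if "j < n" for j
    using that by (simp add: g_def minus_eq l_distr l_minus f_u r_neg)
  have v_g: "v j \<otimes> g = \<zero>" if "j < n" for j
    using that by (simp add: g_def minus_eq r_distr r_minus v_f r_neg)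
  have f_f: "f \<otimes> f = f"
  proof -
    have "f \<otimes> f = (\<Oplus>i\<in>{..<n}. f \<otimes> (u i \<otimes> v i))"
      by (subst (2) f_def, intro finsum_rdistr) auto
    also have "\<dots> = f"
      unfolding f_def[symmetric] by (subst (2) f_def, intro finsum_cong')
        (auto simp: m_assoc[symmetric] f_u)
    finally show ?thesis .
  qed
  have g_g: "g \<otimes> g = g"
    by (simp add: g_def minus_eq l_distr r_distr l_minus r_minus f_f r_neg)
  \<comment> \<open>Primeness is applied twice, to get a nonzero element of
    \<open>e R g R e\<close>, hence a unit of the corner.\<close>
  obtain r where r: "r \<in> carrier R" "e \<otimes> r \<otimes> g \<noteq> \<zero>"
    using prime[of e g] e assms g0 by auto
  then obtain s where s: "s \<in> carrier R" "e \<otimes> r \<otimes> g \<otimes> s \<otimes> e \<noteq> \<zero>"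
    using prime[of "e \<otimes> r \<otimes> g" e] e assms by auto
  define d where "d = e \<otimes> r \<otimes> g \<otimes> s \<otimes> e"
  have "d \<in> carrier (corner R e)"
    using e r s by (auto simp: d_def corner_def m_assoc) (simp add: m_assoc[symmetric])
  then have "d \<in> Units (corner R e)"
    using division_ring.invertible[OF assms(2), of d] s by (auto simp: d_def corner_def)
  then obtain c where c: "c \<in> carrier R" "e \<otimes> c = c" "c \<otimes> e = c" "c \<otimes> d = e"
    by (auto simp: Units_def corner_def)
  \<comment> \<open>The product \<open>c \<otimes> d = e\<close> is cut at \<open>g\<close>. Both
    factors keep a copy of \<open>g\<close>, which does no harm since \<open>g\<close> is
    idempotent.\<close>
  define x where "x = g \<otimes> s \<otimes> e"
  define y where "y = c \<otimes> r \<otimes> g"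
  have xy [simp]: "x \<in> carrier R" "y \<in> carrier R"
    using c r s e by (auto simp: x_def y_def)
  have xe: "x \<otimes> e = x" and ey: "e \<otimes> y = y"
    using c r s e by (auto simp: x_def y_def m_assoc) (simp add: m_assoc[symmetric])
  have yx: "y \<otimes> x = e"
  proof -
    have "y \<otimes> x = c \<otimes> r \<otimes> (g \<otimes> g) \<otimes> s \<otimes> e"
      using c r s e by (simp add: x_def y_def m_assoc)
    also have "\<dots> = (c \<otimes> e) \<otimes> r \<otimes> g \<otimes> s \<otimes> e"
      using c by (simp add: g_g)
    also have "\<dots> = c \<otimes> d"
      using c(1) r s e by (simp add: d_def m_assoc)
    finally show ?thesis
      using c by simp
  qed
  have yu: "y \<otimes> u j = \<zero>" if "j < n" for j
    using that c r by (simp add: y_def m_assoc g_u)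
  have vx: "v j \<otimes> x = \<zero>" if "j < n" for j
    using that s e by (simp add: x_def m_assoc[symmetric] v_g)
  show thesis
  proof
    show "dual_family R e (Suc n) (u(n := x)) (v(n := y))"
      unfolding dual_family_def by (auto simp: less_Suc_eq v_u xe ey yx yu vx)
    \<comment> \<open>\<open>y\<close> witnesses strictness: it kills all the old \<open>u j\<close>
      but sends the new \<open>x\<close> to \<open>e\<close>, which is nonzero.\<close>
    have "y \<in> left_annihilator R (u ` {..<n})"
      by (auto simp: left_annihilator_def yu)
    moreover have "y \<notin> left_annihilator R ((u(n := x)) ` {..<Suc n})"
      using assms(4) by (auto simp: left_annihilator_def yx intro!: bexI[of _ n])
    moreover have "left_annihilator R ((u(n := x)) ` {..<Suc n}) \<subseteq> left_annihilator R (u ` {..<n})"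
      by (auto simp: left_annihilator_def lessThan_Suc)
    ultimately show "left_annihilator R ((u(n := x)) ` {..<Suc n}) \<subset> left_annihilator R (u ` {..<n})"
      by blast
  qed
qed

section \<open>Matrix coordinates from a complete dual family\<close>

text \<open>The double sum is \<open>f \<otimes> r \<otimes> f\<close> multiplied out, a Peirce
  decomposition of \<open>r\<close>.\<close>

lemma expand:
  assumes "f = \<one>" "r \<in> carrier R"
  shows "(\<Oplus>i\<in>{..<n}. \<Oplus>j\<in>{..<n}. u i \<otimes> (v i \<otimes> r \<otimes> u j) \<otimes> v j) = r"
proof -
  have "(\<Oplus>i\<in>{..<n}. \<Oplus>j\<in>{..<n}. u i \<otimes> (v i \<otimes> r \<otimes> u j) \<otimes> v j) =
      (\<Oplus>i\<in>{..<n}. u i \<otimes> v i \<otimes> r)"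
  proof (intro finsum_cong')
    fix i assume i: "i \<in> {..<n}"
    have "(\<Oplus>j\<in>{..<n}. u i \<otimes> (v i \<otimes> r \<otimes> u j) \<otimes> v j) =
        (\<Oplus>j\<in>{..<n}. u i \<otimes> v i \<otimes> r \<otimes> (u j \<otimes> v j))"
      using assms(2) i by (intro finsum_cong') (auto simp: m_assoc)
    also have "\<dots> = u i \<otimes> v i \<otimes> r \<otimes> f"
      unfolding f_def using assms(2) i by (intro finsum_rdistr[symmetric]) auto
    finally show "(\<Oplus>j\<in>{..<n}. u i \<otimes> (v i \<otimes> r \<otimes> u j) \<otimes> v j) = u i \<otimes> v i \<otimes> r"
      using assms i by simp
  qed (use assms in auto)
  also have "\<dots> = f \<otimes> r"
    unfolding f_def using assms(2) by (intro finsum_ldistr[symmetric]) auto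
  finally show ?thesis
    using assms by simp
qed

text \<open>Multiplying by \<open>v k\<close> on the left collapses the outer sum, and by
  \<open>u l\<close> on the right the inner one. Each leaves a factor \<open>e\<close>, absorbed
  because the entries lie in the corner.\<close>

lemma coefficient:
  assumes A: "\<And>i j. i < n \<Longrightarrow> j < n \<Longrightarrow> A i j \<in> carrier (corner R e)" and k: "k < n" "l < n"
  shows "v k \<otimes> (\<Oplus>i\<in>{..<n}. \<Oplus>j\<in>{..<n}. u i \<otimes> A i j \<otimes> v j) \<otimes> u l = A k l"
proof -
  have A' [simp]: "A i j \<in> carrier R" "e \<otimes> A i j = A i j" "A i j \<otimes> e = A i j"
    if "i < n" "j < n" for i j
    using A[OF that] by (auto simp: corner_def)
  have "v k \<otimes> (\<Oplus>i\<in>{..<n}. \<Oplus>j\<in>{..<n}. u i \<otimes> A i j \<otimes> v j) =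
      (\<Oplus>i\<in>{..<n}. v k \<otimes> (\<Oplus>j\<in>{..<n}. u i \<otimes> A i j \<otimes> v j))"
    using k by (intro finsum_rdistr) auto
  also have "\<dots> = (\<Oplus>i\<in>{..<n}. if k = i then (\<Oplus>j\<in>{..<n}. A i j \<otimes> v j) else \<zero>)"
  proof (intro finsum_cong')
    fix i assume i: "i \<in> {..<n}"
    have "v k \<otimes> (\<Oplus>j\<in>{..<n}. u i \<otimes> A i j \<otimes> v j) = (\<Oplus>j\<in>{..<n}. v k \<otimes> (u i \<otimes> A i j \<otimes> v j))"
      using i k by (intro finsum_rdistr) auto
    also have "\<dots> = (\<Oplus>j\<in>{..<n}. if k = i then A i j \<otimes> v j else \<zero>)"
      using i k by (intro finsum_cong') (auto simp: m_assoc[symmetric] v_u)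
    finally show "v k \<otimes> (\<Oplus>j\<in>{..<n}. u i \<otimes> A i j \<otimes> v j) =
        (if k = i then (\<Oplus>j\<in>{..<n}. A i j \<otimes> v j) else \<zero>)"
      by auto
  qed auto
  also have "\<dots> = (\<Oplus>j\<in>{..<n}. A k j \<otimes> v j)"
    using k by (intro add.finprod_singleton) auto
  finally have "v k \<otimes> (\<Oplus>i\<in>{..<n}. \<Oplus>j\<in>{..<n}. u i \<otimes> A i j \<otimes> v j) \<otimes> u l =
      (\<Oplus>j\<in>{..<n}. A k j \<otimes> v j) \<otimes> u l"
    by simp
  also have "\<dots> = (\<Oplus>j\<in>{..<n}. A k j \<otimes> v j \<otimes> u l)"
    using k by (intro finsum_ldistr) auto
  \<comment> \<open>The test is written \<open>l = j\<close>, with the fixed index first, to fit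
    \<open>add.finprod_singleton\<close>.\<close>
  also have "\<dots> = (\<Oplus>j\<in>{..<n}. if l = j then A k j else \<zero>)"
    using k by (intro finsum_cong') (auto simp: m_assoc v_u)
  also have "\<dots> = A k l"
    using k by (intro add.finprod_singleton) auto
  finally show ?thesis .
qed

text \<open>Multiplicativity comes from inserting \<open>\<one> = f\<close> between two factors. For
  bijectivity, \<open>expand\<close> and \<open>coefficient\<close> are the two identities saying
  that \<open>?\<psi>\<close> is inverse to \<open>\<phi>\<close>.\<close>

lemma iso_matrix_ring:
  assumes f1: "f = \<one>"
  shows "R \<simeq> matrix_ring n (corner R e)"
proof -
  define \<phi> where "\<phi> r = (\<lambda>(i, j) \<in> {..<n} \<times> {..<n}. v i \<otimes> r \<otimes> u j)" for r
  have entry: "v i \<otimes> r \<otimes> u j \<in> carrier (corner R e)" if "r \<in> carrier R" "i < n" "j < n" for i j r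
    using that e by (auto simp: corner_def m_assoc) (simp add: m_assoc[symmetric])
  have mult: "v i \<otimes> (r \<otimes> s) \<otimes> u j =
      finsum (corner R e) (\<lambda>k. (v i \<otimes> r \<otimes> u k) \<otimes> (v k \<otimes> s \<otimes> u j)) {..<n}"
    if rs: "r \<in> carrier R" "s \<in> carrier R" and ij: "i < n" "j < n" for r s i j
  proof -
    interpret C: ring "corner R e"
      using e by (rule corner_ring)
    have [simp]: "mult (corner R e) = mult R"
      by (simp add: corner_def)
    have "finsum (corner R e) (\<lambda>k. (v i \<otimes> r \<otimes> u k) \<otimes> (v k \<otimes> s \<otimes> u j)) {..<n} =
        (\<Oplus>k\<in>{..<n}. (v i \<otimes> r \<otimes> u k) \<otimes> (v k \<otimes> s \<otimes> u j))"
      using rs ij e entry C.m_closed by (intro finsum_corner) auto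
    also have "\<dots> = (\<Oplus>k\<in>{..<n}. (v i \<otimes> r) \<otimes> (u k \<otimes> v k) \<otimes> (s \<otimes> u j))"
      using rs ij by (intro finsum_cong') (auto simp: m_assoc)
    also have "\<dots> = (\<Oplus>k\<in>{..<n}. (v i \<otimes> r) \<otimes> (u k \<otimes> v k)) \<otimes> (s \<otimes> u j)"
      using rs ij by (intro finsum_ldistr[symmetric]) auto
    \<comment> \<open>Here the middle factors \<open>u k \<otimes> v k\<close> add up to
      \<open>f\<close>, which is then replaced by \<open>\<one>\<close>.\<close>
    also have "(\<Oplus>k\<in>{..<n}. (v i \<otimes> r) \<otimes> (u k \<otimes> v k)) = (v i \<otimes> r) \<otimes> f"
      unfolding f_def using rs ij by (intro finsum_rdistr[symmetric]) auto
    finally show ?thesis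
      using rs ij f1 by (simp add: m_assoc)
  qed
  have "\<phi> \<in> ring_hom R (matrix_ring n (corner R e))"
  proof (rule ring_hom_memI)
    fix x y assume xy: "x \<in> carrier R" "y \<in> carrier R"
    show "\<phi> x \<in> carrier (matrix_ring n (corner R e))"
      using xy entry by (auto simp: \<phi>_def matrix_ring_def)
    show "\<phi> (x \<otimes> y) = \<phi> x \<otimes>\<^bsub>matrix_ring n (corner R e)\<^esub> \<phi> y"
    proof -
      have "finsum (corner R e) (\<lambda>k. (v i \<otimes> x \<otimes> u k) \<otimes> (v k \<otimes> y \<otimes> u j)) {..<n} =
          finsum (corner R e) (\<lambda>k. \<phi> x (i, k) \<otimes>\<^bsub>corner R e\<^esub> \<phi> y (k, j)) {..<n}"
        if ij: "i < n" "j < n" for i j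
      proof -
        interpret C: ring "corner R e"
          using e by (rule corner_ring)
        have [simp]: "mult (corner R e) = mult R"
          by (simp add: corner_def)
        show ?thesis
          using ij xy entry C.m_closed by (intro C.finsum_cong') (auto simp: \<phi>_def)
      qed
      then show ?thesis
        using xy mult by (subst \<phi>_def) (auto simp: matrix_ring_def fun_eq_iff restrict_def)
    qed
    show "\<phi> (x \<oplus> y) = \<phi> x \<oplus>\<^bsub>matrix_ring n (corner R e)\<^esub> \<phi> y"
      using xy by (auto simp: \<phi>_def matrix_ring_def corner_def fun_eq_iff restrict_def l_distr r_distr)
  next
    show "\<phi> \<one> = \<one>\<^bsub>matrix_ring n (corner R e)\<^esub>"
      by (auto simp: \<phi>_def matrix_ring_def corner_def fun_eq_iff restrict_def v_u)
  qed
  moreover have "bij_betw \<phi> (carrier R) (carrier (matrix_ring n (corner R e)))"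
  proof (rule bij_betw_byWitness)
    let ?\<psi> = "\<lambda>A. \<Oplus>i\<in>{..<n}. \<Oplus>j\<in>{..<n}. u i \<otimes> A (i, j) \<otimes> v j"
    show "\<forall>r\<in>carrier R. ?\<psi> (\<phi> r) = r"
    proof
      fix r assume r: "r \<in> carrier R"
      have "?\<psi> (\<phi> r) = (\<Oplus>i\<in>{..<n}. \<Oplus>j\<in>{..<n}. u i \<otimes> (v i \<otimes> r \<otimes> u j) \<otimes> v j)"
        using r by (intro finsum_cong') (auto simp: \<phi>_def intro!: finsum_cong')
      then show "?\<psi> (\<phi> r) = r"
        using expand[OF f1 r] by simp
    qed
    show "\<forall>A\<in>carrier (matrix_ring n (corner R e)). \<phi> (?\<psi> A) = A"
    proof
      fix A assume A: "A \<in> carrier (matrix_ring n (corner R e))"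
      then have A': "A (i, j) \<in> carrier (corner R e)" if "i < n" "j < n" for i j
        using that by (auto simp: matrix_ring_def)
      show "\<phi> (?\<psi> A) = A"
      \<comment> \<open>Both matrices are extensional, so comparing entries on the index square
        suffices.\<close>
      proof (rule PiE_ext)
        show "A \<in> {..<n} \<times> {..<n} \<rightarrow>\<^sub>E carrier (corner R e)"
          using A by (simp add: matrix_ring_def)
        have "v k \<otimes> ?\<psi> A \<otimes> u l = A (k, l)" if "k < n" "l < n" for k l
          using coefficient[of "\<lambda>i j. A (i, j)", OF A' that] by simp
        then show "\<phi> (?\<psi> A) x = A x" if "x \<in> {..<n} \<times> {..<n}" for x
          using that by (auto simp: \<phi>_def)
        then show "\<phi> (?\<psi> A) \<in> {..<n} \<times> {..<n} \<rightarrow>\<^sub>E carrier (corner R e)"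
          using A' by (auto simp: PiE_iff) (auto simp: \<phi>_def)
      qed
    qed
    show "\<phi> ` carrier R \<subseteq> carrier (matrix_ring n (corner R e))"
      using entry by (auto simp: \<phi>_def matrix_ring_def split: if_splits)
    show "?\<psi> ` carrier (matrix_ring n (corner R e)) \<subseteq> carrier R"
    proof safe
      fix A assume "A \<in> carrier (matrix_ring n (corner R e))"
      then have "A (i, j) \<in> carrier R" if "i < n" "j < n" for i j
        using that by (force simp: matrix_ring_def corner_def)
      then show "?\<psi> A \<in> carrier R"
        by (intro finsum_closed) auto
    qed
  qed
  ultimately show ?thesis
    by (auto simp: is_ring_iso_def ring_iso_def)
qed

end

section \<open>Existence of a complete dual family and the structure theorem\<close>

theorem theorem1p1:
  fixes R :: "('a, 'm) ring_scheme"
  assumes "simple_ring R" and "left_artinian_ring R"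
  shows "\<exists>(D :: 'a ring) (n :: nat). division_ring D \<and> n > 0 \<and> R \<simeq> matrix_ring n D"
proof -
  interpret simple_ring R by fact
  interpret left_artinian_ring R by fact
  have "left_ideal (carrier R) R"
    by (rule left_idealI) auto
  then have "{L. left_ideal L R \<and> L \<noteq> {\<zero>\<^bsub>R\<^esub>}} \<noteq> {}"
    using nonzero by blast
  from minimal_left_ideal_in[OF _ this] obtain L
    where L: "left_ideal L R" "L \<noteq> {\<zero>\<^bsub>R\<^esub>}"
      and min: "\<And>J. left_ideal J R \<Longrightarrow> J \<subseteq> L \<Longrightarrow> J \<noteq> {\<zero>\<^bsub>R\<^esub>} \<Longrightarrow> J = L"
    by blast
  obtain e where e: "e \<in> L" "e \<noteq> \<zero>\<^bsub>R\<^esub>" "e \<otimes>\<^bsub>R\<^esub> e = e"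
    by (rule idempotent_of_minimal_left_ideal[OF assms(1) L min])
  have D: "division_ring (corner R e)"
    by (rule corner_division_ring[OF L(1) min e])
  interpret L: left_ideal L R
    by (rule L(1))
  have eR: "e \<in> carrier R" and e_nonzero: "e \<noteq> \<zero>\<^bsub>R\<^esub>"
    using e by auto
  \<comment> \<open>The size \<open>n\<close> varies over the whole collection. A minimal member
    belongs to a family that \<open>extend\<close> cannot prolong, which forces
    \<open>f = \<one>\<close>.\<close>
  define \<S> where "\<S> = {left_annihilator R (u ` {..<n}) | n u v. dual_family R e n u v}"
  have "left_ideal I R" if I: "I \<in> \<S>" for I
  proof -
    obtain n u v where "I = left_annihilator R (u ` {..<n})" "dual_family R e n u v"
      using I unfolding \<S>_def by blast
    then show ?thesis
      by (auto simp: dual_family_def intro: left_ideal_annihilator)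
  qed
  \<comment> \<open>The empty family makes \<open>\<S>\<close> inhabited; the constant functions are
    mere placeholders.\<close>
  moreover have "dual_family R e 0 (\<lambda>_. e) (\<lambda>_. e)"
    by (simp add: dual_family_def)
  then have "\<S> \<noteq> {}"
    unfolding \<S>_def by blast
  ultimately have "\<exists>L\<in>\<S>. \<forall>L'\<in>\<S>. L' \<subseteq> L \<longrightarrow> L' = L"
    by (rule minimal_left_ideal_in)
  then obtain I where I: "I \<in> \<S>" "\<And>J. J \<in> \<S> \<Longrightarrow> J \<subseteq> I \<Longrightarrow> J = I"
    by blast
  then obtain n u v where I_eq: "I = left_annihilator R (u ` {..<n})"
    and dual: "dual_family R e n u v"
    unfolding \<S>_def by blast
  interpret dual_basis R e n u v
    by unfold_locales (rule eR e(3) dual)+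
  have f1: "f = \<one>\<^bsub>R\<^esub>"
  proof (rule ccontr)
    assume "f \<noteq> \<one>\<^bsub>R\<^esub>"
    then obtain x y where xy: "dual_family R e (Suc n) (u(n := x)) (v(n := y))"
      "left_annihilator R ((u(n := x)) ` {..<Suc n}) \<subset> I"
      unfolding I_eq by (rule extend[OF assms(1) D _ e_nonzero])
    moreover have "left_annihilator R ((u(n := x)) ` {..<Suc n}) \<in> \<S>"
      using xy(1) unfolding \<S>_def by blast
    ultimately show False
      using I(2) by blast
  qed
  have "n > 0"
  proof (rule ccontr)
    assume "\<not> n > 0"
    \<comment> \<open>For \<open>n = 0\<close> the sum \<open>f\<close> is empty, so completeness
      would make the ring trivial.\<close>
    then have "\<one>\<^bsub>R\<^esub> = \<zero>\<^bsub>R\<^esub>"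
      using f1 unfolding f_def by simp
    then show False
      using nonzero one_zeroD by blast
  qed
  then show ?thesis
    using D iso_matrix_ring[OF f1] by blast
qed

end
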